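(* Let $G$ be a finite simple graph and let $v \in V(G)$ be a vertex such that $\{v\} \subsetneq N_G[v] \subsetneq V(G)$ and $N_G[v]$ is a clique. Let $k$ be the number of universal vertices of $G$. For every $u \in N_G(v)$, let $\mathcal{V}_u$ be an acyclic matching on $\mathcal{I}(G - N_G[u])$. Then there is an acyclic matching $\mathcal{V}$ on $\mathcal{I}(G)$ such that (i) $f_0^{\mathcal{V}}(\mathcal{I}(G)) = 1 + k$, which equals the number of connected components of $\mathcal{I}(G)$; (ii) $f_1^{\mathcal{V}}(\mathcal{I}(G)) = \sum_{u \in N_G(v)} f_0^{\mathcal{V}_u}(\mathcal{I}(G - N_G[u])) - (|N_G(v)| - k)$; (iii) for every $t \geq 2$, $f_t^{\mathcal{V}}(\mathcal{I}(G)) = \sum_{u \in N_G(v)} f_{t-1}^{\mathcal{V}_u}(\mathcal{I}(G - N_G[u]))$.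
   Context: Graphs are finite, simple and undirected. $N_G(v)$ is the set of neighbours of $v$ and $N_G[v] = N_G(v) \sqcup \{v\}$. A vertex is universal if it is adjacent to all other vertices. For $U \subseteq V(G)$, $G - U$ is the subgraph induced on $V(G)\setminus U$ (possibly the empty graph). The independence complex $\mathcal{I}(G)$ is the abstract simplicial complex whose simplices are the independent sets of $G$ (including $\emptyset$); a simplex with $d+1$ elements has dimension $d$. An acyclic matching on a simplicial complex $\mathcal{X}$ is a set $\mathcal{V}$ of pairs $(\alpha,\beta)$ of simplices of $\mathcal{X}$ with $\alpha \subseteq \beta$ and $\dim\beta = \dim\alpha + 1$ (the empty simplex may occur, with dimension $-1$), each simplex appearing in at most one pair, such that the directed graph obtained from the Hasse diagram of $\mathcal{X}$ (edges $\beta \to \alpha$ for codimension-one faces $\alpha\subsetneq\beta$) by reversing the edges in $\mathcal{V}$ has no directed cycle. A non-empty simplex is $\mathcal{V}$-critical if it is not in any pair of $\mathcal{V}$ or is paired with $\emptyset$. $f_d^{\mathcal{V}}(\mathcal{X})$ denotes the number of $d$-dimensional $\mathcal{V}$-critical simplices. *)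

theory Defs
  imports "Graph_Theory.Digraph_Component"
begin

text \<open>Finite simple undirected graphs are the finite symmetric digraphs without loops and
  parallel arcs, i.e. the locale \<^locale>\<open>graph\<close>; adjacency is \<open>u \<rightarrow>\<^bsub>G\<^esub> w\<close> and
  \<open>G \<restriction> U\<close> is the induced subgraph. The vertex set may be empty.\<close>

definition nbhd :: "('a, 'b) pre_digraph \<Rightarrow> 'a \<Rightarrow> 'a set" where
  "nbhd G v = {w \<in> verts G. v \<rightarrow>\<^bsub>G\<^esub> w}"

definition closed_nbhd :: "('a, 'b) pre_digraph \<Rightarrow> 'a \<Rightarrow> 'a set" where
  "closed_nbhd G v = insert v (nbhd G v)"

definition clique :: "('a, 'b) pre_digraph \<Rightarrow> 'a set \<Rightarrow> bool" where
  "clique G C \<longleftrightarrow> C \<subseteq> verts G \<and> (\<forall>x\<in>C. \<forall>y\<in>C. x \<noteq> y \<longrightarrow> x \<rightarrow>\<^bsub>G\<^esub> y)"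

definition universal_vertex :: "('a, 'b) pre_digraph \<Rightarrow> 'a \<Rightarrow> bool" where
  "universal_vertex G u \<longleftrightarrow> u \<in> verts G \<and> (\<forall>w\<in>verts G. w \<noteq> u \<longrightarrow> u \<rightarrow>\<^bsub>G\<^esub> w)"

definition delete_verts :: "('a, 'b) pre_digraph \<Rightarrow> 'a set \<Rightarrow> ('a, 'b) pre_digraph" where
  "delete_verts G U = G \<restriction> (verts G - U)"

text \<open>A simplicial complex is represented by the set of its simplices, which are finite sets
  and include \<open>{}\<close>; its vertex set is the union of its simplices.\<close>

definition independence_complex :: "('a, 'b) pre_digraph \<Rightarrow> 'a set set" where
  "independence_complex G = {S. S \<subseteq> verts G \<and> (\<forall>x\<in>S. \<forall>y\<in>S. \<not> x \<rightarrow>\<^bsub>G\<^esub> y)}"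

definition sdim :: "'a set \<Rightarrow> int" where
  "sdim \<sigma> = int (card \<sigma>) - 1"

text \<open>Two vertices of a complex are in the same connected component iff they are joined by a path of
  edges (simplices of dimension 1). A component is represented by its set of vertices. In the
  relation below the degenerate case \<open>x = y\<close> is harmless.\<close>

definition edge_rel :: "'a set set \<Rightarrow> ('a \<times> 'a) set" where
  "edge_rel X = {(x, y). {x, y} \<in> X}"

definition connected_components :: "'a set set \<Rightarrow> 'a set set" where
  "connected_components X = \<Union>X // ((edge_rel X)\<^sup>* \<inter> (\<Union>X \<times> \<Union>X))"

definition hasse :: "'a set set \<Rightarrow> ('a set \<times> 'a set) set" where
  "hasse X = {(\<beta>, \<alpha>). \<beta> \<in> X \<and> \<alpha> \<in> X \<and> \<alpha> \<subset> \<beta> \<and> sdim \<beta> = sdim \<alpha> + 1}"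

definition acyclic_matching :: "'a set set \<Rightarrow> ('a set \<times> 'a set) set \<Rightarrow> bool" where
  "acyclic_matching X M \<longleftrightarrow>
     (\<forall>(\<alpha>, \<beta>)\<in>M. \<alpha> \<in> X \<and> \<beta> \<in> X \<and> \<alpha> \<subseteq> \<beta> \<and> sdim \<beta> = sdim \<alpha> + 1) \<and>
     (\<forall>p\<in>M. \<forall>q\<in>M. p \<noteq> q \<longrightarrow> {fst p, snd p} \<inter> {fst q, snd q} = {}) \<and>
     acyclic ((hasse X - M\<inverse>) \<union> M)"

definition critical :: "'a set set \<Rightarrow> ('a set \<times> 'a set) set \<Rightarrow> 'a set \<Rightarrow> bool" where
  "critical X M \<sigma> \<longleftrightarrow>
     \<sigma> \<in> X \<and> \<sigma> \<noteq> {} \<and> ((\<forall>(\<alpha>, \<beta>)\<in>M. \<sigma> \<noteq> \<alpha> \<and> \<sigma> \<noteq> \<beta>) \<or> ({}, \<sigma>) \<in> M)"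

definition num_critical :: "nat \<Rightarrow> ('a set \<times> 'a set) set \<Rightarrow> 'a set set \<Rightarrow> nat" where
  "num_critical d M X = card {\<sigma>. critical X M \<sigma> \<and> sdim \<sigma> = int d}"

end

theory Submission
  imports Defs
begin

text \<open>The neighbours of \<open>v\<close> form a clique, so an independent set contains at most one of them. Those
  containing none form a cone with apex \<open>v\<close> and are matched by toggling \<open>v\<close>, which leaves only \<open>{v}\<close>
  critical. Those containing \<open>u\<close> are the sets \<open>insert u \<tau>\<close> with \<open>\<tau>\<close> in the independence complex of
  \<open>G - N[u]\<close>, the link of \<open>u\<close>, and are matched by a copy of \<open>\<V> u\<close>. Before copying, \<open>\<V> u\<close> is extended
  by a pair consisting of \<open>{}\<close> and a critical vertex whenever it leaves \<open>{}\<close> unmatched although the link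
  has vertices; this does not change the critical simplices but makes \<open>{u}\<close> matched unless \<open>u\<close> is
  universal. The union is acyclic because no step of the modified Hasse diagram adds an element of \<open>N(v)\<close>,
  so a cycle stays within one of the pieces.\<close>

section \<open>Acyclicity along order-preserving maps\<close>

text \<open>A cycle in \<open>S\<close> is carried by \<open>f\<close> to a closed walk of positive
  length in \<open>R\<close>. The map may identify points, so injectivity is not asked for.\<close>

lemma acyclic_map:
  assumes "acyclic R" and "\<And>x y. (x, y) \<in> S \<Longrightarrow> (f x, f y) \<in> R"
  shows "acyclic S"
proof -
  have "(f x, f y) \<in> R\<^sup>+" if "(x, y) \<in> S\<^sup>+" for x y
    using that by induction (auto intro: assms(2) trancl_into_trancl)
  with assms(1) show ?thesis
    by (auto simp: acyclic_def)
qed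

text \<open>The value of \<open>f\<close> never rises along a cycle and must return to its start, so
  it is constant and the cycle lies in one fibre. This is the patchwork principle of discrete Morse
  theory.\<close>

lemma acyclic_fibres:
  fixes f :: "'a \<Rightarrow> 'b::order"
  assumes mono: "\<And>x y. (x, y) \<in> R \<Longrightarrow> f y \<le> f x"
    and fib: "\<And>c. acyclic {(x, y) \<in> R. f x = c \<and> f y = c}"
  shows "acyclic R"
proof -
  \<comment> \<open>The path inside the fibre is claimed only if the end values agree; antisymmetry
    then fixes all values in between.\<close>
  have "f y \<le> f x \<and> (f y = f x \<longrightarrow> (x, y) \<in> {(a, b) \<in> R. f a = f x \<and> f b = f x}\<^sup>+)"
    if "(x, y) \<in> R\<^sup>+" for x y
    using that
  proof induction
    case (base y)
    then show ?case using mono by auto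
  next
    case (step y z)
    have le: "f z \<le> f y" using mono step.hyps by blast
    show ?case
    proof (intro conjI impI)
      show "f z \<le> f x" using le step.IH by (metis order.trans)
      assume eq: "f z = f x"
      then have "f y = f x" using le step.IH by (metis order.antisym)
      then show "(x, z) \<in> {(a, b) \<in> R. f a = f x \<and> f b = f x}\<^sup>+"
        using step eq by (auto intro: trancl_into_trancl)
    qed
  qed
  then show ?thesis
    using fib by (fastforce simp: acyclic_def)
qed

lemma acyclic_decreasing:
  fixes f :: "'a \<Rightarrow> nat"
  assumes "\<And>x y. (x, y) \<in> R \<Longrightarrow> f y < f x"
  shows "acyclic R"
proof -
  have "R\<inverse> \<subseteq> measure f" using assms by auto
  then have "acyclic (R\<inverse>)"
    by (meson acyclic_subset wf_acyclic wf_measure)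
  then show ?thesis by simp
qed

section \<open>Matchings on families of finite sets\<close>

text \<open>In contrast to \<open>critical\<close>, the empty simplex gets no special treatment.
  This is the notion that survives \<open>insert u\<close>, where \<open>{}\<close> becomes the
  ordinary vertex \<open>{u}\<close>.\<close>

definition unmatched :: "('a set \<times> 'a set) set \<Rightarrow> 'a set \<Rightarrow> bool" where
  "unmatched M \<sigma> \<longleftrightarrow> (\<forall>(\<alpha>, \<beta>)\<in>M. \<sigma> \<noteq> \<alpha> \<and> \<sigma> \<noteq> \<beta>)"

text \<open>The index is a cardinality, one more than the dimension, so that index 0 can count
  \<open>{}\<close>.\<close>

definition num_unmatched :: "nat \<Rightarrow> ('a set \<times> 'a set) set \<Rightarrow> 'a set set \<Rightarrow> nat" where
  "num_unmatched n M X = card {\<sigma> \<in> X. unmatched M \<sigma> \<and> card \<sigma> = n}"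

abbreviation modified_hasse :: "'a set set \<Rightarrow> ('a set \<times> 'a set) set \<Rightarrow> ('a set \<times> 'a set) set" where
  "modified_hasse X M \<equiv> (hasse X - M\<inverse>) \<union> M"

lemma critical_unmatched:
  "critical X M \<sigma> \<longleftrightarrow> \<sigma> \<in> X \<and> \<sigma> \<noteq> {} \<and> (unmatched M \<sigma> \<or> ({}, \<sigma>) \<in> M)"
  by (auto simp: critical_def unmatched_def)

lemma acyclic_matchingI:
  assumes "\<And>\<alpha> \<beta>. (\<alpha>, \<beta>) \<in> M \<Longrightarrow> \<alpha> \<in> X \<and> \<beta> \<in> X \<and> \<alpha> \<subseteq> \<beta> \<and> card \<beta> = Suc (card \<alpha>)"
    and "\<And>p q. \<lbrakk>p \<in> M; q \<in> M; p \<noteq> q\<rbrakk> \<Longrightarrow> {fst p, snd p} \<inter> {fst q, snd q} = {}"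
    and "acyclic (modified_hasse X M)"
  shows "acyclic_matching X M"
  unfolding acyclic_matching_def
proof (intro conjI ballI impI)
  fix p assume "p \<in> M"
  then show "case p of (\<alpha>, \<beta>) \<Rightarrow> \<alpha> \<in> X \<and> \<beta> \<in> X \<and> \<alpha> \<subseteq> \<beta> \<and> sdim \<beta> = sdim \<alpha> + 1"
    using assms(1) by (cases p) (auto simp: sdim_def)
qed (use assms(2,3) in auto)

lemma acyclic_matchingD:
  assumes "acyclic_matching X M"
  shows acyclic_matching_pair:
      "(\<alpha>, \<beta>) \<in> M \<Longrightarrow> \<alpha> \<in> X \<and> \<beta> \<in> X \<and> \<alpha> \<subseteq> \<beta> \<and> card \<beta> = Suc (card \<alpha>)"
    and acyclic_matching_disjoint:
      "\<lbrakk>p \<in> M; q \<in> M; p \<noteq> q\<rbrakk> \<Longrightarrow> {fst p, snd p} \<inter> {fst q, snd q} = {}"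
    and acyclic_matching_acyclic: "acyclic (modified_hasse X M)"
  using assms by (auto simp: acyclic_matching_def sdim_def)

lemma hasse_iff:
  "(\<beta>, \<alpha>) \<in> hasse X \<longleftrightarrow> \<beta> \<in> X \<and> \<alpha> \<in> X \<and> \<alpha> \<subset> \<beta> \<and> card \<beta> = Suc (card \<alpha>)"
  by (auto simp: hasse_def sdim_def)

text \<open>Otherwise every vertex is matched upwards to an edge, and walking on to the other end of that edge
  never stops.\<close>

lemma acyclic_matching_unmatched_vertex:
  assumes M: "acyclic_matching X M" and fin: "finite X"
    and down: "\<forall>\<sigma>\<in>X. Pow \<sigma> \<subseteq> X"
    and vertex: "{x} \<in> X" and empty: "unmatched M {}"
  obtains w where "{w} \<in> X" "unmatched M {w}"
proof -
  let ?R = "modified_hasse X M"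
  have "?R \<subseteq> X \<times> X"
    using acyclic_matching_pair[OF M] by (auto simp: hasse_def)
  then have "finite ?R" using fin by (meson finite_SigmaI finite_subset)
  then have "wf ((?R\<inverse>)\<^sup>+)"
    using acyclic_matching_acyclic[OF M] by (simp add: finite_acyclic_wf_converse wf_trancl)
  \<comment> \<open>A vertex from which no path of positive length in \<open>?R\<close> leads to a
    vertex.\<close>
  then obtain s where s: "s \<in> {{y} | y. {y} \<in> X}"
    and least: "\<And>t. (t, s) \<in> (?R\<inverse>)\<^sup>+ \<Longrightarrow> t \<notin> {{y} | y. {y} \<in> X}"
    using vertex by (metis (mono_tags, lifting) mem_Collect_eq wfE_min)
  from s obtain y where y: "s = {y}" "{y} \<in> X" by auto
  have "unmatched M {y}"
  proof (rule ccontr)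
    assume "\<not> unmatched M {y}"
    then obtain \<alpha> \<beta> where ab: "(\<alpha>, \<beta>) \<in> M" "{y} = \<alpha> \<or> {y} = \<beta>"
      by (auto simp: unmatched_def)
    note pr = acyclic_matching_pair[OF M ab(1)]
    \<comment> \<open>As an upper element, \<open>{y}\<close> would be paired with
      \<open>{}\<close>, which is unmatched.\<close>
    have "{y} \<noteq> \<beta>"
    proof
      assume b: "{y} = \<beta>"
      have "finite \<alpha>" using pr unfolding b[symmetric] by (meson finite.simps finite_subset)
      moreover have "card \<alpha> = 0" using pr unfolding b[symmetric] by simp
      ultimately have "\<alpha> = {}" by simp
      then show False using ab empty by (auto simp: unmatched_def)
    qed
    then have al: "\<alpha> = {y}" using ab by simp
    then have "card \<beta> = 2" "y \<in> \<beta>" using pr by auto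
    then obtain z where z: "\<beta> = {y, z}" "z \<noteq> y"
      by (metis card_2_iff doubleton_eq_iff insertE singletonD)
    have zX: "{z} \<in> X" using down pr z by auto
    \<comment> \<open>The edge is already paired with \<open>{y}\<close>, so its arc down to
      \<open>{z}\<close> is not reversed and \<open>{y}\<close> reaches \<open>{z}\<close>, against
      the choice of \<open>y\<close>.\<close>
    have "({z}, \<beta>) \<notin> M"
      using acyclic_matching_disjoint[OF M, of "({z}, \<beta>)" "({y}, \<beta>)"] ab al z by auto
    then have "(\<beta>, {z}) \<in> ?R"
      using pr zX z by (auto simp: hasse_iff)
    moreover have "({y}, \<beta>) \<in> ?R" using ab al by auto
    ultimately have "({z}, {y}) \<in> (?R\<inverse>)\<^sup>+"
      by (meson converse.intros r_into_trancl trancl_trans)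
    then show False using least y zX by blast
  qed
  with y that show ?thesis by blast
qed

text \<open>If \<open>{}\<close> is matched already, \<open>M\<close> itself serves. Otherwise an
  unmatched vertex becomes the partner of \<open>{}\<close>, and both before and after it counts as
  critical.\<close>

lemma acyclic_matching_extend_empty:
  assumes M: "acyclic_matching X M" and fin: "finite X"
    and down: "\<forall>\<sigma>\<in>X. Pow \<sigma> \<subseteq> X"
    and vertex: "{x} \<in> X"
  obtains M' w where "acyclic_matching X M'" "({}, {w}) \<in> M'"
    "\<And>\<sigma>. critical X M' \<sigma> \<longleftrightarrow> critical X M \<sigma>"
proof (cases "unmatched M {}")
  case False
  then obtain \<alpha> \<beta> where ab: "(\<alpha>, \<beta>) \<in> M" "\<alpha> = {} \<or> \<beta> = {}"
    by (auto simp: unmatched_def)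
  note pr = acyclic_matching_pair[OF M ab(1)]
  have "\<alpha> = {}" "card \<beta> = 1" using pr ab by auto
  then obtain w where "({}, {w}) \<in> M"
    using ab by (metis card_1_singletonE)
  with that M show ?thesis by blast
next
  case True
  obtain w where w: "{w} \<in> X" "unmatched M {w}"
    using acyclic_matching_unmatched_vertex[OF M fin down vertex True] by blast
  let ?M = "insert ({}, {w}) M"
  let ?R = "(hasse X - ?M\<inverse>) \<union> M"
  have eX: "{} \<in> X" using down vertex by blast
  \<comment> \<open>Once \<open>({}, {w})\<close> is reversed, no arc leaves \<open>{w}\<close>, so the new arc lies on no cycle.\<close>
  have sink: "({w}, t) \<notin> ?R" for t
  proof
    assume "({w}, t) \<in> ?R"
    then have "({w}, t) \<in> hasse X" "t \<noteq> {}"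
      using w(2) by (auto simp: unmatched_def)
    then show False by (auto simp: hasse_iff)
  qed
  have "acyclic ?R"
    by (rule acyclic_subset[OF acyclic_matching_acyclic[OF M]]) auto
  moreover have "({w}, {}) \<notin> ?R\<^sup>*"
    using sink by (metis converse_rtranclE insert_not_empty)
  ultimately have "acyclic (insert ({}, {w}) ?R)"
    by (simp add: acyclic_insert)
  then have ac: "acyclic (modified_hasse X ?M)" by simp
  have "acyclic_matching X ?M"
  proof (rule acyclic_matchingI)
    show "\<alpha> \<in> X \<and> \<beta> \<in> X \<and> \<alpha> \<subseteq> \<beta> \<and> card \<beta> = Suc (card \<alpha>)" if "(\<alpha>, \<beta>) \<in> ?M" for \<alpha> \<beta>
      using that acyclic_matching_pair[OF M] eX w by auto
    show "{fst p, snd p} \<inter> {fst q, snd q} = {}" if "p \<in> ?M" "q \<in> ?M" "p \<noteq> q" for p q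
      using that True w(2) acyclic_matching_disjoint[OF M, of p q]
      by (fastforce simp: unmatched_def)
  qed (rule ac)
  moreover have "critical X ?M \<sigma> \<longleftrightarrow> critical X M \<sigma>" for \<sigma>
    using True w by (auto simp: critical_unmatched unmatched_def)
  ultimately show ?thesis using that by blast
qed

text \<open>Converts critical counts into plain unmatched counts, the form that can be glued. If
  there are vertices, one critical vertex is spent on \<open>{}\<close>, hence the shift by one in
  dimension 0; in \<open>{{}}\<close> nothing can be paired and \<open>{}\<close> stays
  unmatched.\<close>

lemma acyclic_matching_reduced:
  assumes M: "acyclic_matching X M" and fin: "finite X"
    and fins: "\<And>\<sigma>. \<sigma> \<in> X \<Longrightarrow> finite \<sigma>"
    and down: "\<forall>\<sigma>\<in>X. Pow \<sigma> \<subseteq> X"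
    and empty: "{} \<in> X"
  obtains M' where "acyclic_matching X M'"
    "num_unmatched 0 M' X = of_bool (X = {{}})"
    "num_critical 0 M X = num_unmatched 1 M' X + of_bool (X \<noteq> {{}})"
    "\<And>t. t \<ge> 1 \<Longrightarrow> num_critical t M X = num_unmatched (Suc t) M' X"
proof (cases "X = {{}}")
  case True
  have "M = {}"
    using acyclic_matching_pair[OF M] unfolding True by fastforce
  then have "num_unmatched n M X = of_bool (n = 0)" for n
    unfolding num_unmatched_def True unmatched_def by (cases n) (auto simp: Collect_conv_if)
  moreover have "num_critical t M X = 0" for t
    using True by (auto simp: num_critical_def critical_def)
  ultimately show ?thesis using that M True by simp
next
  case False
  then obtain \<sigma> x where "\<sigma> \<in> X" "x \<in> \<sigma>" using empty by blast
  then have "{x} \<in> X" using down by blast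
  then obtain M' w where M': "acyclic_matching X M'" "({}, {w}) \<in> M'"
    "\<And>\<sigma>. critical X M' \<sigma> \<longleftrightarrow> critical X M \<sigma>"
    using acyclic_matching_extend_empty[OF M fin down] by blast
  note pair = acyclic_matching_pair[OF M'(1)]
  have only: "\<sigma> = {w}" if "({}, \<sigma>) \<in> M'" for \<sigma>
    using acyclic_matching_disjoint[OF M'(1) that M'(2)] by auto
  have wX: "{w} \<in> X" using pair M'(2) by blast
  have nu: "\<not> unmatched M' {w}" "\<not> unmatched M' {}"
    using M'(2) by (auto simp: unmatched_def)
  have crit_M: "critical X M \<sigma> \<longleftrightarrow> \<sigma> \<in> X \<and> \<sigma> \<noteq> {} \<and> (unmatched M' \<sigma> \<or> ({}, \<sigma>) \<in> M')" for \<sigma>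
    using M'(3)[of \<sigma>] unfolding critical_unmatched[of X M'] by simp
  \<comment> \<open>The partner \<open>{w}\<close> of \<open>{}\<close> is matched and yet critical,
    so it is listed separately in dimension 0.\<close>
  have crit: "{\<sigma>. critical X M \<sigma> \<and> sdim \<sigma> = int t} =
      {\<sigma> \<in> X. unmatched M' \<sigma> \<and> card \<sigma> = Suc t} \<union> (if t = 0 then {{w}} else {})" for t
  proof (rule set_eqI)
    fix \<sigma> :: "'a set"
    have "critical X M \<sigma> \<and> sdim \<sigma> = int t \<longleftrightarrow>
        \<sigma> \<in> X \<and> unmatched M' \<sigma> \<and> card \<sigma> = Suc t \<or> t = 0 \<and> \<sigma> = {w}"
    proof (cases "\<sigma> = {w}")
      case True
      then have "critical X M \<sigma>" "\<not> unmatched M' \<sigma>" "sdim \<sigma> = 0"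
        using wX M'(2) nu unfolding crit_M by (simp_all add: sdim_def)
      with True show ?thesis by auto
    next
      case False
      then have "critical X M \<sigma> \<longleftrightarrow> \<sigma> \<in> X \<and> \<sigma> \<noteq> {} \<and> unmatched M' \<sigma>"
        using only unfolding crit_M by blast
      moreover have "sdim \<sigma> = int t \<longleftrightarrow> card \<sigma> = Suc t" by (auto simp: sdim_def)
      moreover have "card \<sigma> = Suc t \<Longrightarrow> \<sigma> \<noteq> {}" by auto
      ultimately show ?thesis using False by blast
    qed
    then show "\<sigma> \<in> {\<sigma>. critical X M \<sigma> \<and> sdim \<sigma> = int t} \<longleftrightarrow>
        \<sigma> \<in> {\<sigma> \<in> X. unmatched M' \<sigma> \<and> card \<sigma> = Suc t} \<union> (if t = 0 then {{w}} else {})"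
      by simp
  qed
  have "num_critical 0 M X = num_unmatched 1 M' X + 1"
    unfolding num_critical_def num_unmatched_def crit using nu fin by simp
  moreover have "num_critical t M X = num_unmatched (Suc t) M' X" if "t \<ge> 1" for t
    unfolding num_critical_def num_unmatched_def crit using that by simp
  \<comment> \<open>Infinite sets also have \<open>card\<close> 0; \<open>fins\<close> rules them
    out, leaving only the matched set \<open>{}\<close>.\<close>
  moreover have "{\<sigma> \<in> X. unmatched M' \<sigma> \<and> card \<sigma> = 0} = {}"
    using nu(2) fins by (metis (mono_tags, lifting) card_0_eq empty_Collect_eq)
  then have "num_unmatched 0 M' X = 0" unfolding num_unmatched_def by (simp only: card.empty)
  ultimately show ?thesis using that M'(1) False by simp
qed

section \<open>Gluing a cone and matchings on links\<close>

text \<open>The map \<open>insert u\<close> is a bijection from this set onto the simplices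
  containing \<open>u\<close>.\<close>

definition link :: "'a set set \<Rightarrow> 'a \<Rightarrow> 'a set set" where
  "link X u = {\<tau>. u \<notin> \<tau> \<and> insert u \<tau> \<in> X}"

text \<open>The graph-free setting of the construction: \<open>cone\<close> handles the simplices
  that avoid \<open>N\<close>, and \<open>at_most_one\<close> sorts the others by their single
  element of \<open>N\<close>. The matchings \<open>W u\<close> are free to match \<open>{}\<close>
  or not.\<close>

locale cone_with_links =
  fixes X :: "'a set set" and N :: "'a set" and v :: 'a and W :: "'a \<Rightarrow> ('a set \<times> 'a set) set"
  assumes finite_complex: "finite X"
    and finite_simplex: "\<sigma> \<in> X \<Longrightarrow> finite \<sigma>"
    and down_closed: "\<lbrakk>\<sigma> \<in> X; \<tau> \<subseteq> \<sigma>\<rbrakk> \<Longrightarrow> \<tau> \<in> X"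
    and empty_simplex: "{} \<in> X"
    and apex_notin: "v \<notin> N"
    and cone: "\<lbrakk>\<sigma> \<in> X; \<sigma> \<inter> N = {}\<rbrakk> \<Longrightarrow> insert v \<sigma> \<in> X"
    and at_most_one: "\<lbrakk>\<sigma> \<in> X; x \<in> \<sigma>; y \<in> \<sigma>; x \<in> N; y \<in> N\<rbrakk> \<Longrightarrow> x = y"
    and link_matching: "u \<in> N \<Longrightarrow> acyclic_matching (link X u) (W u)"
    and finite_N: "finite N"
begin

definition cone_part :: "('a set \<times> 'a set) set" where
  "cone_part = {(\<sigma>, insert v \<sigma>) | \<sigma>. \<sigma> \<in> X \<and> \<sigma> \<inter> N = {} \<and> v \<notin> \<sigma>}"

definition link_part :: "'a \<Rightarrow> ('a set \<times> 'a set) set" where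
  "link_part u = {(insert u \<alpha>, insert u \<beta>) | \<alpha> \<beta>. (\<alpha>, \<beta>) \<in> W u}"

definition glued :: "('a set \<times> 'a set) set" where
  "glued = cone_part \<union> (\<Union>u\<in>N. link_part u)"

lemma cone_partD:
  assumes "(\<alpha>, \<beta>) \<in> cone_part"
  shows "\<alpha> \<in> X" "\<beta> \<in> X" "\<alpha> \<inter> N = {}" "\<beta> \<inter> N = {}" "v \<notin> \<alpha>" "\<beta> = insert v \<alpha>"
    "card \<beta> = Suc (card \<alpha>)"
  using assms cone apex_notin finite_simplex by (auto simp: cone_part_def)

lemma inter_N:
  assumes "\<sigma> \<in> X" "u \<in> \<sigma>" "u \<in> N"
  shows "\<sigma> \<inter> N = {u}"
  using assms at_most_one by blast

lemma link_partD:
  assumes "(\<alpha>, \<beta>) \<in> link_part u" "u \<in> N"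
  shows "\<alpha> \<in> X" "\<beta> \<in> X" "\<alpha> \<inter> N = {u}" "\<beta> \<inter> N = {u}" "\<alpha> \<subseteq> \<beta>"
    "(\<alpha> - {u}, \<beta> - {u}) \<in> W u" "card \<beta> = Suc (card \<alpha>)"
proof -
  obtain a b where ab: "(a, b) \<in> W u" "\<alpha> = insert u a" "\<beta> = insert u b"
    using assms by (auto simp: link_part_def)
  have p: "a \<in> link X u" "b \<in> link X u" "a \<subseteq> b" "card b = Suc (card a)"
    using acyclic_matching_pair[OF link_matching[OF assms(2)] ab(1)] by auto
  show X: "\<alpha> \<in> X" "\<beta> \<in> X" using p ab by (auto simp: link_def)
  show "\<alpha> \<inter> N = {u}" "\<beta> \<inter> N = {u}" using inter_N[OF X(1)] inter_N[OF X(2)] ab assms by auto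
  show "\<alpha> \<subseteq> \<beta>" using p ab by auto
  have u: "u \<notin> a" "u \<notin> b" using p by (auto simp: link_def)
  then show "(\<alpha> - {u}, \<beta> - {u}) \<in> W u" using ab by simp
  have "finite a" "finite b" using X ab finite_simplex by fastforce+
  then show "card \<beta> = Suc (card \<alpha>)" using u ab p by simp
qed

lemma gluedE:
  assumes "(\<alpha>, \<beta>) \<in> glued"
  obtains (cone) "(\<alpha>, \<beta>) \<in> cone_part"
    | (link) u where "u \<in> N" "(\<alpha>, \<beta>) \<in> link_part u"
  using assms by (auto simp: glued_def)

text \<open>The last equation matters most: no pair adds or removes an element of \<open>N\<close>,
  so the trace \<open>\<sigma> \<inter> N\<close> is constant on pairs.\<close>

lemma glued_pair:
  assumes "(\<alpha>, \<beta>) \<in> glued"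
  shows "\<alpha> \<in> X" "\<beta> \<in> X" "\<alpha> \<subseteq> \<beta>" "card \<beta> = Suc (card \<alpha>)" "\<alpha> \<inter> N = \<beta> \<inter> N"
proof -
  from assms have "\<alpha> \<in> X \<and> \<beta> \<in> X \<and> \<alpha> \<subseteq> \<beta> \<and> card \<beta> = Suc (card \<alpha>) \<and> \<alpha> \<inter> N = \<beta> \<inter> N"
  proof (cases rule: gluedE)
    case cone
    from cone_partD[OF this] show ?thesis by auto
  next
    case (link u)
    from link_partD[OF link(2,1)] show ?thesis by auto
  qed
  then show "\<alpha> \<in> X" "\<beta> \<in> X" "\<alpha> \<subseteq> \<beta>" "card \<beta> = Suc (card \<alpha>)" "\<alpha> \<inter> N = \<beta> \<inter> N" by auto
qed

text \<open>Cone pairs have empty trace on \<open>N\<close> and pairs of \<open>link_part u\<close>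
  have trace \<open>{u}\<close>, so the trace tells which part a pair comes from.\<close>

lemma glued_empty_fibre:
  assumes "(\<alpha>, \<beta>) \<in> glued" "\<alpha> \<inter> N = {}"
  shows "(\<alpha>, \<beta>) \<in> cone_part"
  using assms(1)
proof (cases rule: gluedE)
  case (link u)
  then show ?thesis using link_partD(3)[OF link(2,1)] assms(2) by simp
qed

lemma glued_link_fibre:
  assumes "(\<alpha>, \<beta>) \<in> glued" "\<alpha> \<inter> N = {u}"
  shows "(\<alpha>, \<beta>) \<in> link_part u"
  using assms(1)
proof (cases rule: gluedE)
  case cone
  then show ?thesis using cone_partD(3)[OF cone] assms(2) by simp
next
  case (link w)
  then show ?thesis using link_partD(3)[OF link(2,1)] assms(2) by simp
qed

lemma fibre_cases:
  assumes "\<sigma> \<in> X"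
  obtains "\<sigma> \<inter> N = {}" | u where "u \<in> N" "u \<in> \<sigma>" "\<sigma> \<inter> N = {u}" "\<sigma> - {u} \<in> link X u"
proof (cases "\<sigma> \<inter> N = {}")
  case False
  then obtain u where "u \<in> N" "u \<in> \<sigma>" by auto
  moreover from this have "\<sigma> - {u} \<in> link X u"
    using assms by (simp add: link_def insert_absorb)
  ultimately show ?thesis using that inter_N assms by blast
qed (use that in blast)

section \<open>Acyclicity of the glued matching, fibre by fibre\<close>

lemma acyclic_empty_fibre:
  "acyclic {(\<sigma>, \<tau>) \<in> modified_hasse X glued. \<sigma> \<inter> N = {} \<and> \<tau> \<inter> N = {}}" (is "acyclic ?R")
  \<comment> \<open>An apex once added is never removed, and where it is kept or missing throughout only down-steps remain.\<close>
proof (rule acyclic_fibres[where f = "\<lambda>\<sigma>. v \<notin> \<sigma>"])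
  fix \<sigma> \<tau> assume st: "(\<sigma>, \<tau>) \<in> ?R"
  \<comment> \<open>On \<open>bool\<close> the order is implication, so this says that an apex in
    \<open>\<sigma>\<close> stays in \<open>\<tau>\<close>.\<close>
  show "(v \<notin> \<tau>) \<le> (v \<notin> \<sigma>)"
  proof (cases "(\<sigma>, \<tau>) \<in> glued")
    case True
    then show ?thesis using glued_pair(3) by fastforce
  next
    case False
    then have h: "\<tau> \<in> X" "\<sigma> \<in> X" "\<tau> \<subset> \<sigma>" "card \<sigma> = Suc (card \<tau>)" "(\<tau>, \<sigma>) \<notin> glued"
      using st by (auto simp: hasse_iff)
    \<comment> \<open>A down-step losing \<open>v\<close> would run along a cone pair, and that arc
      is reversed.\<close>
    have "v \<in> \<tau>" if "v \<in> \<sigma>"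
    proof (rule ccontr)
      assume "v \<notin> \<tau>"
      then have "insert v \<tau> = \<sigma>"
        using h that finite_simplex by (intro card_subset_eq) auto
      then show False using h \<open>v \<notin> \<tau>\<close> st by (auto simp: glued_def cone_part_def)
    qed
    then show ?thesis by auto
  qed
next
  fix c
  show "acyclic {(\<sigma>, \<tau>) \<in> ?R. (v \<notin> \<sigma>) = c \<and> (v \<notin> \<tau>) = c}"
  proof (rule acyclic_decreasing[where f = card])
    fix \<sigma> \<tau> assume st: "(\<sigma>, \<tau>) \<in> {(\<sigma>, \<tau>) \<in> ?R. (v \<notin> \<sigma>) = c \<and> (v \<notin> \<tau>) = c}"
    \<comment> \<open>A pair of empty trace adds \<open>v\<close>, so its two ends cannot share the
      value \<open>c\<close>.\<close>
    then have "(\<sigma>, \<tau>) \<notin> glued"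
      using glued_empty_fibre[of \<sigma> \<tau>] cone_partD(5,6)[of \<sigma> \<tau>] by auto
    then show "card \<tau> < card \<sigma>" using st by (auto simp: hasse_iff)
  qed
qed

text \<open>Deleting \<open>u\<close> carries every arc of this fibre to an arc of the modified
  Hasse diagram of the link, which is acyclic.\<close>

lemma acyclic_link_fibre:
  assumes u: "u \<in> N"
  shows "acyclic {(\<sigma>, \<tau>) \<in> modified_hasse X glued. \<sigma> \<inter> N = {u} \<and> \<tau> \<inter> N = {u}}" (is "acyclic ?R")
proof (rule acyclic_map[OF acyclic_matching_acyclic[OF link_matching[OF u]], where f = "\<lambda>\<sigma>. \<sigma> - {u}"])
  fix \<sigma> \<tau> assume st: "(\<sigma>, \<tau>) \<in> ?R"
  show "(\<sigma> - {u}, \<tau> - {u}) \<in> modified_hasse (link X u) (W u)"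
  proof (cases "(\<sigma>, \<tau>) \<in> glued")
    case True
    then have "(\<sigma>, \<tau>) \<in> link_part u" using glued_link_fibre st by simp
    from link_partD(6)[OF this u] show ?thesis by simp
  next
    case False
    then have h: "\<tau> \<in> X" "\<sigma> \<in> X" "\<tau> \<subset> \<sigma>" "card \<sigma> = Suc (card \<tau>)" "(\<tau>, \<sigma>) \<notin> glued"
      "u \<in> \<sigma>" "u \<in> \<tau>"
      using st by (auto simp: hasse_iff)
    have "card (\<sigma> - {u}) = Suc (card (\<tau> - {u}))"
      using h finite_simplex by (metis card.remove old.nat.inject)
    then have "(\<sigma> - {u}, \<tau> - {u}) \<in> hasse (link X u)"
      using h by (auto simp: hasse_iff link_def insert_absorb)
    \<comment> \<open>An arc reversed in the link comes from a pair whose copy is in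
      \<open>glued\<close>, so it would be reversed in \<open>X\<close> too.\<close>
    moreover have "(\<tau> - {u}, \<sigma> - {u}) \<notin> W u"
    proof
      assume "(\<tau> - {u}, \<sigma> - {u}) \<in> W u"
      then have "(insert u (\<tau> - {u}), insert u (\<sigma> - {u})) \<in> link_part u"
        unfolding link_part_def by blast
      then show False using h u by (auto simp: glued_def insert_absorb)
    qed
    ultimately show ?thesis by auto
  qed
qed

text \<open>Patches the fibres of the trace on \<open>N\<close>, ordered by inclusion: pairs keep
  the trace and down-steps can only shrink it.\<close>

lemma acyclic_glued: "acyclic (modified_hasse X glued)"
proof (rule acyclic_fibres[where f = "\<lambda>\<sigma>. \<sigma> \<inter> N"])
  show "\<tau> \<inter> N \<subseteq> \<sigma> \<inter> N" if "(\<sigma>, \<tau>) \<in> modified_hasse X glued" for \<sigma> \<tau>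
    using that glued_pair(5) by (fastforce simp: hasse_iff)
  fix c
  let ?R = "{(\<sigma>, \<tau>) \<in> modified_hasse X glued. \<sigma> \<inter> N = c \<and> \<tau> \<inter> N = c}"
  have sub: "modified_hasse X glued \<subseteq> X \<times> X"
    using glued_pair by (auto simp: hasse_iff)
  show "acyclic ?R"
  proof (cases "c = {} \<or> (\<exists>u\<in>N. c = {u})")
    case True
    then show ?thesis using acyclic_empty_fibre acyclic_link_fibre by auto
  next
    \<comment> \<open>No simplex has any other trace, so the remaining fibres carry no arcs.\<close>
    case False
    have "\<sigma> \<inter> N \<noteq> c" if "\<sigma> \<in> X" for \<sigma>
      using that False by (cases rule: fibre_cases) auto
    with sub have "?R = {}" by fast
    then show ?thesis by (simp only: acyclic_def trancl_empty) simp
  qed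
qed

lemma acyclic_matching_glued: "acyclic_matching X glued"
proof (rule acyclic_matchingI)
  show "\<alpha> \<in> X \<and> \<beta> \<in> X \<and> \<alpha> \<subseteq> \<beta> \<and> card \<beta> = Suc (card \<alpha>)" if "(\<alpha>, \<beta>) \<in> glued" for \<alpha> \<beta>
    using glued_pair that by blast
  fix p q assume pq: "p \<in> glued" "q \<in> glued" "p \<noteq> q"
  obtain a b c d where [simp]: "p = (a, b)" "q = (c, d)" by (cases p, cases q)
  have N: "a \<inter> N = b \<inter> N" "c \<inter> N = d \<inter> N" and X: "a \<in> X"
    using glued_pair pq by auto
  \<comment> \<open>Pairs of different trace share nothing; pairs of equal trace come from the same
    part.\<close>
  show "{fst p, snd p} \<inter> {fst q, snd q} = {}"
  proof (cases "a \<inter> N = c \<inter> N")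
    case False
    then show ?thesis using N by auto
  next
    case True
    from X show ?thesis
    proof (cases rule: fibre_cases)
      case 1
      then have "(a, b) \<in> cone_part" "(c, d) \<in> cone_part"
        using pq True glued_empty_fibre by auto
      from cone_partD(5,6)[OF this(1)] cone_partD(5,6)[OF this(2)] pq(3)
      show ?thesis by auto
    next
      case (2 u)
      then have l: "(a, b) \<in> link_part u" "(c, d) \<in> link_part u"
        using pq True glued_link_fibre by auto
      note D = link_partD(3,4,6)[OF l(1) 2(1)] link_partD(3,4,6)[OF l(2) 2(1)]
      \<comment> \<open>Deleting \<open>u\<close> is injective on sets containing \<open>u\<close>,
        so distinct pairs stay distinct in \<open>W u\<close>, where disjointness is known.\<close>
      have "u \<in> a" "u \<in> b" "u \<in> c" "u \<in> d" using D by blast+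
      then have inj: "a - {u} = c - {u} \<longleftrightarrow> a = c" "b - {u} = d - {u} \<longleftrightarrow> b = d"
        "a - {u} = d - {u} \<longleftrightarrow> a = d" "b - {u} = c - {u} \<longleftrightarrow> b = c"
        by blast+
      have "(a - {u}, b - {u}) \<noteq> (c - {u}, d - {u})"
        using inj pq(3) by simp
      from acyclic_matching_disjoint[OF link_matching[OF 2(1)] D(3) D(6) this]
      have "a \<noteq> c" "a \<noteq> d" "b \<noteq> c" "b \<noteq> d" by auto
      then show ?thesis by simp
    qed
  qed
qed (rule acyclic_glued)

section \<open>Critical simplices of the glued matching\<close>

lemma unmatched_glued_empty_fibre:
  assumes "\<sigma> \<in> X" "\<sigma> \<inter> N = {}"
  shows "\<not> unmatched glued \<sigma>"
proof (cases "v \<in> \<sigma>")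
  case True
  have "\<sigma> - {v} \<in> X" using assms down_closed by blast
  then have "(\<sigma> - {v}, insert v (\<sigma> - {v})) \<in> glued"
    using assms by (auto simp: glued_def cone_part_def)
  then have "(\<sigma> - {v}, \<sigma>) \<in> glued" using True by (simp add: insert_absorb)
  then show ?thesis by (auto simp: unmatched_def)
next
  case False
  then have "(\<sigma>, insert v \<sigma>) \<in> glued" using assms by (auto simp: glued_def cone_part_def)
  then show ?thesis by (auto simp: unmatched_def)
qed

text \<open>A simplex of trace \<open>{u}\<close> can only be met by pairs of
  \<open>link_part u\<close>, and these correspond to the pairs of \<open>W u\<close>.\<close>

lemma unmatched_glued_link_fibre:
  assumes u: "u \<in> N" and t: "\<tau> \<in> link X u"
  shows "unmatched glued (insert u \<tau>) \<longleftrightarrow> unmatched (W u) \<tau>"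
proof
  assume un: "unmatched glued (insert u \<tau>)"
  have "(insert u \<alpha>, insert u \<beta>) \<in> glued" if "(\<alpha>, \<beta>) \<in> W u" for \<alpha> \<beta>
    using that u by (auto simp: glued_def link_part_def)
  with un show "unmatched (W u) \<tau>" unfolding unmatched_def by blast
next
  assume un: "unmatched (W u) \<tau>"
  have ut: "u \<notin> \<tau>" "insert u \<tau> \<in> X" using t by (auto simp: link_def)
  have N: "insert u \<tau> \<inter> N = {u}" using inter_N ut u by blast
  show "unmatched glued (insert u \<tau>)"
    unfolding unmatched_def
  proof safe
    fix \<beta> assume "(insert u \<tau>, \<beta>) \<in> glued"
    then have "(insert u \<tau> - {u}, \<beta> - {u}) \<in> W u"
      using link_partD(6)[OF glued_link_fibre[OF _ N] u] by simp
    then show False using un ut by (auto simp: unmatched_def)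
  next
    fix \<alpha> assume g: "(\<alpha>, insert u \<tau>) \<in> glued"
    then have "(\<alpha> - {u}, insert u \<tau> - {u}) \<in> W u"
      using link_partD(6)[OF glued_link_fibre[OF g] u] N glued_pair(5)[OF g] by simp
    then show False using un ut by (auto simp: unmatched_def)
  qed
qed

text \<open>The simplex \<open>{v}\<close> is critical through its pair with \<open>{}\<close>.
  Adding \<open>u\<close> raises the dimension by one, so cardinality \<open>t\<close> in the link
  gives dimension \<open>t\<close> here, with \<open>\<tau> = {}\<close> giving
  \<open>{u}\<close>.\<close>

lemma critical_glued:
  "{\<sigma>. critical X glued \<sigma> \<and> sdim \<sigma> = int t} =
    (if t = 0 then {{v}} else {}) \<union>
    (\<Union>u\<in>N. insert u ` {\<tau> \<in> link X u. unmatched (W u) \<tau> \<and> card \<tau> = t})" (is "?L = ?A \<union> ?B")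
proof -
  have e: "({}, {v}) \<in> glued" using empty_simplex by (auto simp: glued_def cone_part_def)
  have vX: "{v} \<in> X" using cone empty_simplex by blast
  have only: "\<sigma> = {v}" if "({}, \<sigma>) \<in> glued" for \<sigma>
    using cone_partD(6)[OF glued_empty_fibre[OF that]] by simp
  have fin: "finite \<tau>" "u \<notin> \<tau>" if "\<tau> \<in> link X u" for \<tau> u
    using that finite_simplex[of "insert u \<tau>"] by (auto simp: link_def)
  have "\<sigma> \<in> ?A \<union> ?B" if "\<sigma> \<in> ?L" for \<sigma>
  proof -
    have s: "\<sigma> \<in> X" "unmatched glued \<sigma> \<or> ({}, \<sigma>) \<in> glued" "card \<sigma> = Suc t"
      using that by (auto simp: critical_unmatched sdim_def)
    show ?thesis
    proof (cases "({}, \<sigma>) \<in> glued")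
      case True
      then have "\<sigma> = {v}" by (rule only)
      then show ?thesis using s(3) by simp
    next
      case False
      then have un: "unmatched glued \<sigma>" using s by blast
      from s(1) show ?thesis
      proof (cases rule: fibre_cases)
        case 1
        then show ?thesis using unmatched_glued_empty_fibre s(1) un by blast
      next
        case (2 u)
        then have "unmatched (W u) (\<sigma> - {u})"
          using unmatched_glued_link_fibre[OF 2(1,4)] un by (simp add: insert_absorb)
        moreover have "card (\<sigma> - {u}) = t" using 2(2) s(3) by simp
        ultimately have "\<sigma> - {u} \<in> {\<tau> \<in> link X u. unmatched (W u) \<tau> \<and> card \<tau> = t}"
          using 2(4) by simp
        then have "insert u (\<sigma> - {u}) \<in> ?B" by (intro UN_I[OF 2(1)] image_eqI[OF refl])
        then show ?thesis using 2(2) by (simp add: insert_absorb)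
      qed
    qed
  qed
  moreover have "\<sigma> \<in> ?L" if "\<sigma> \<in> ?A" for \<sigma>
    using that e vX by (auto simp: critical_unmatched sdim_def split: if_splits)
  moreover have "\<sigma> \<in> ?L" if B: "\<sigma> \<in> ?B" for \<sigma>
  proof -
    obtain u \<tau> where u: "u \<in> N" and t: "\<tau> \<in> link X u" "unmatched (W u) \<tau>" "card \<tau> = t"
      and eq: "\<sigma> = insert u \<tau>"
      using B by auto
    have "unmatched glued \<sigma>" using unmatched_glued_link_fibre[OF u t(1)] t(2) eq by simp
    moreover have "\<sigma> \<in> X" using t(1) eq by (simp add: link_def)
    moreover have "sdim \<sigma> = int t" using fin[OF t(1)] t(3) eq by (simp add: sdim_def)
    ultimately show ?thesis using eq by (simp add: critical_unmatched)
  qed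
  ultimately show ?thesis by blast
qed

text \<open>The pieces for different \<open>u\<close> are disjoint by \<open>at_most_one\<close>,
  and \<open>insert u\<close> is injective on the link, so the counts add up. The
  \<open>of_bool\<close> term counts \<open>{v}\<close>.\<close>

lemma num_critical_glued:
  "num_critical t glued X = of_bool (t = 0) + (\<Sum>u\<in>N. num_unmatched t (W u) (link X u))"
proof -
  let ?S = "\<lambda>u. {\<tau> \<in> link X u. unmatched (W u) \<tau> \<and> card \<tau> = t}"
  let ?B = "\<Union>u\<in>N. insert u ` ?S u"
  have "insert u ` ?S u \<subseteq> X" for u by (auto simp: link_def)
  then have fin: "finite (insert u ` ?S u)" for u
    using finite_complex finite_subset by blast
  have dis: "insert u ` ?S u \<inter> insert u' ` ?S u' = {}" if "u \<in> N" "u' \<in> N" "u \<noteq> u'" for u u'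
  proof -
    have False if "\<sigma> \<in> insert u ` ?S u" "\<sigma> \<in> insert u' ` ?S u'" for \<sigma>
    proof -
      have "\<sigma> \<in> X" "u \<in> \<sigma>" "u' \<in> \<sigma>" using that by (auto simp: link_def)
      then show False using at_most_one \<open>u \<in> N\<close> \<open>u' \<in> N\<close> \<open>u \<noteq> u'\<close> by blast
    qed
    then show ?thesis by blast
  qed
  have "inj_on (insert u) (?S u)" for u
    by (auto simp: inj_on_def link_def)
  then have "card ?B = (\<Sum>u\<in>N. num_unmatched t (W u) (link X u))"
    using fin dis finite_N by (subst card_UN_disjoint) (auto simp: card_image num_unmatched_def)
  moreover have "{v} \<notin> ?B" using apex_notin by auto
  moreover have "finite ?B" using fin finite_N by blast
  ultimately show ?thesis
    unfolding num_critical_def critical_glued by auto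
qed

end

section \<open>Independence complexes\<close>

lemma dominates_induce_subgraph:
  "x \<rightarrow>\<^bsub>G \<restriction> S\<^esub> y \<longleftrightarrow> x \<in> S \<and> y \<in> S \<and> x \<rightarrow>\<^bsub>G\<^esub> y"
  by (auto simp: arcs_ends_conv)

context graph
begin

lemma adj_sym: "u \<rightarrow> w \<longleftrightarrow> w \<rightarrow> u"
  using arcs_ends_symmetric[OF sym_arcs] by blast

lemma in_nbhd: "w \<in> nbhd G u \<longleftrightarrow> u \<rightarrow> w"
  by (auto simp: nbhd_def adj_in_verts)

lemma independence_complex_finite: "finite (independence_complex G)"
  by (rule finite_subset[of _ "Pow (verts G)"]) (auto simp: independence_complex_def)

lemma independence_complex_finite_simplex: "\<sigma> \<in> independence_complex G \<Longrightarrow> finite \<sigma>"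
  using finite_subset[OF _ finite_verts] by (simp add: independence_complex_def)

text \<open>A new vertex \<open>u\<close> can be added to an independent set exactly if that set
  avoids \<open>closed_nbhd G u\<close>. This identifies the complexes of the theorem with the links
  used in gluing.\<close>

lemma link_independence_complex:
  assumes "u \<in> verts G"
  shows "independence_complex (delete_verts G (closed_nbhd G u)) = link (independence_complex G) u"
proof (rule set_eqI)
  fix \<tau>
  have loop: "\<not> u \<rightarrow> u" using adj_not_same by metis
  have sym: "(\<forall>x\<in>\<tau>. \<not> x \<rightarrow> u) \<longleftrightarrow> (\<forall>x\<in>\<tau>. \<not> u \<rightarrow> x)" using adj_sym by metis
  have "\<tau> \<in> link (independence_complex G) u \<longleftrightarrow>
      u \<notin> \<tau> \<and> \<tau> \<subseteq> verts G \<and> (\<forall>x\<in>\<tau>. \<not> u \<rightarrow> x) \<and> (\<forall>x\<in>\<tau>. \<forall>y\<in>\<tau>. \<not> x \<rightarrow> y)"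
    using assms by (simp add: link_def independence_complex_def loop ball_conj_distrib sym)
  moreover have "\<tau> \<subseteq> verts G - closed_nbhd G u \<longleftrightarrow> u \<notin> \<tau> \<and> \<tau> \<subseteq> verts G \<and> (\<forall>x\<in>\<tau>. \<not> u \<rightarrow> x)"
    unfolding closed_nbhd_def by (auto simp: in_nbhd)
  moreover have "\<tau> \<in> independence_complex (delete_verts G (closed_nbhd G u)) \<longleftrightarrow>
      \<tau> \<subseteq> verts G - closed_nbhd G u \<and> (\<forall>x\<in>\<tau>. \<forall>y\<in>\<tau>. \<not> x \<rightarrow> y)"
    unfolding independence_complex_def delete_verts_def dominates_induce_subgraph
      induce_subgraph_verts mem_Collect_eq by fast
  ultimately show "\<tau> \<in> independence_complex (delete_verts G (closed_nbhd G u)) \<longleftrightarrow>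
      \<tau> \<in> link (independence_complex G) u" by argo
qed

text \<open>A vertex \<open>w\<close> other than \<open>u\<close> and not adjacent to it is the same
  as a simplex \<open>{w}\<close> of the link. Through this the number of universal vertices enters
  the counts.\<close>

lemma link_trivial_iff_universal:
  assumes u: "u \<in> verts G"
  shows "link (independence_complex G) u = {{}} \<longleftrightarrow> universal_vertex G u"
proof
  assume triv: "link (independence_complex G) u = {{}}"
  have "u \<rightarrow> w" if "w \<in> verts G" "w \<noteq> u" for w
  proof (rule ccontr)
    assume "\<not> u \<rightarrow> w"
    then have "{w} \<in> link (independence_complex G) u"
      using that u adj_not_same adj_sym[of w u] by (auto simp: link_def independence_complex_def)
    with triv show False by simp
  qed
  with u show "universal_vertex G u" by (simp add: universal_vertex_def)
next
  assume univ: "universal_vertex G u"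
  have "\<tau> = {}" if t: "\<tau> \<in> link (independence_complex G) u" for \<tau>
  proof (rule ccontr)
    assume "\<tau> \<noteq> {}"
    then obtain w where "w \<in> \<tau>" by blast
    with t univ show False
      by (auto simp: link_def independence_complex_def universal_vertex_def)
  qed
  moreover have "{} \<in> link (independence_complex G) u"
    using u adj_not_same by (auto simp: link_def independence_complex_def)
  ultimately show "link (independence_complex G) u = {{}}" by blast
qed

end

section \<open>Graphs with a simplicial vertex that is not universal\<close>

locale simplicial_vertex = graph +
  fixes v
  assumes vertex: "v \<in> verts G"
    and not_dominating: "closed_nbhd G v \<subset> verts G"
    and clique_nbhd: "clique G (closed_nbhd G v)"
begin

lemma nbhd_adj: "\<lbrakk>x \<in> nbhd G v; y \<in> nbhd G v; x \<noteq> y\<rbrakk> \<Longrightarrow> x \<rightarrow> y"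
  using clique_nbhd by (auto simp: clique_def closed_nbhd_def)

lemma not_universal: "\<not> universal_vertex G v"
  using not_dominating by (auto simp: universal_vertex_def closed_nbhd_def nbhd_def)

text \<open>Ensures that a sum over the neighbours of \<open>v\<close> sees all universal
  vertices.\<close>

lemma universal_in_nbhd:
  assumes "universal_vertex G u"
  shows "u \<in> nbhd G v"
proof -
  have "v \<noteq> u" using not_universal assms by blast
  then have "u \<rightarrow> v" using assms vertex by (simp add: universal_vertex_def)
  then show ?thesis by (simp add: in_nbhd adj_sym[of v u])
qed

lemma finite_nbhd: "finite (nbhd G v)"
  by (simp add: nbhd_def)

text \<open>The clique condition yields \<open>at_most_one\<close>, and \<open>cone\<close> holds
  because \<open>v\<close> is adjacent only to members of \<open>nbhd G v\<close>.\<close>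

lemma cone_with_links_independence_complex:
  assumes "\<And>u. u \<in> nbhd G v \<Longrightarrow> acyclic_matching (link (independence_complex G) u) (W u)"
  shows "cone_with_links (independence_complex G) (nbhd G v) v W"
proof unfold_locales
  show "x = y"
    if "\<sigma> \<in> independence_complex G" "x \<in> \<sigma>" "y \<in> \<sigma>" "x \<in> nbhd G v" "y \<in> nbhd G v" for \<sigma> x y
    using that nbhd_adj unfolding independence_complex_def by blast
  show "insert v \<sigma> \<in> independence_complex G"
    if "\<sigma> \<in> independence_complex G" "\<sigma> \<inter> nbhd G v = {}" for \<sigma>
  proof -
    have "\<not> v \<rightarrow> x \<and> \<not> x \<rightarrow> v" if "x \<in> \<sigma>" for x
      using that \<open>\<sigma> \<inter> nbhd G v = {}\<close> in_nbhd[of x v] adj_sym[of x v] by auto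
    moreover have "\<not> v \<rightarrow> v" using adj_not_same by blast
    ultimately show ?thesis
      using that vertex by (simp add: independence_complex_def)
  qed
  show "v \<notin> nbhd G v" using adj_not_same by (auto simp: in_nbhd)
  show "\<tau> \<in> independence_complex G" if "\<sigma> \<in> independence_complex G" "\<tau> \<subseteq> \<sigma>" for \<sigma> \<tau>
    using that by (auto simp: independence_complex_def)
  show "{} \<in> independence_complex G" by (simp add: independence_complex_def)
  show "finite \<sigma>" if "\<sigma> \<in> independence_complex G" for \<sigma>
    using that by (rule independence_complex_finite_simplex)
qed (fact independence_complex_finite finite_nbhd assms)+

text \<open>A universal vertex is isolated in the complex, while every other vertex reaches
  \<open>v\<close> along at most two edges.\<close>

lemma card_connected_components:
  "card (connected_components (independence_complex G)) = 1 + card {u. universal_vertex G u}"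
proof -
  let ?I = "independence_complex G" and ?U = "{u. universal_vertex G u}"
  let ?E = "edge_rel ?I"
  let ?R = "?E\<^sup>* \<inter> \<Union>?I \<times> \<Union>?I"
  \<comment> \<open>This covers \<open>x = y\<close>, since \<open>{x}\<close> is
    independent.\<close>
  have E: "(x, y) \<in> ?E \<longleftrightarrow> x \<in> verts G \<and> y \<in> verts G \<and> \<not> x \<rightarrow>\<^bsub>G\<^esub> y" for x y
    using adj_not_same adj_sym by (auto simp: edge_rel_def independence_complex_def)
  have V: "\<Union>?I = verts G"
  proof
    show "\<Union>?I \<subseteq> verts G" by (auto simp: independence_complex_def)
    have "{x} \<in> ?I" if "x \<in> verts G" for x
      using that adj_not_same by (auto simp: independence_complex_def)
    then show "verts G \<subseteq> \<Union>?I" by blast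
  qed
  have "sym ?E" unfolding sym_def E using adj_sym by blast
  then have sym: "sym (?E\<^sup>*)" by (rule sym_rtrancl)
  have univ: "x = y" if "(x, y) \<in> ?E" "x \<in> ?U \<or> y \<in> ?U" for x y
  proof (rule ccontr)
    assume "x \<noteq> y"
    moreover have "x \<in> verts G" "y \<in> verts G" "\<not> x \<rightarrow>\<^bsub>G\<^esub> y" using that(1) E by simp_all
    moreover from this have "\<not> y \<rightarrow>\<^bsub>G\<^esub> x" using adj_sym by simp
    ultimately show False using that(2) unfolding universal_vertex_def by auto
  qed
  have stay: "y = x" if "(x, y) \<in> ?E\<^sup>*" "x \<in> ?U \<or> y \<in> ?U" for x y
    using that
  proof (induction rule: rtrancl_induct)
    case (step y z)
    then show ?case using univ[of y z] by metis
  qed simp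
  have to_v: "(x, v) \<in> ?E\<^sup>*" if x: "x \<in> verts G - ?U" for x
  proof (cases "x \<in> nbhd G v")
    case False
    then have "\<not> x \<rightarrow> v" using in_nbhd adj_sym[of x v] by simp
    then have "(x, v) \<in> ?E" using x vertex by (simp add: E)
    then show ?thesis by (rule r_into_rtrancl)
  next
    case True
    obtain w where w: "w \<in> verts G" "w \<noteq> x" "\<not> x \<rightarrow> w"
      using x by (auto simp: universal_vertex_def)
    \<comment> \<open>If \<open>w\<close> were a neighbour of \<open>v\<close>, the clique condition
      would make it adjacent to \<open>x\<close>. So the complex has the path from \<open>x\<close>
      over \<open>w\<close> to \<open>v\<close>.\<close>
    then have "\<not> w \<rightarrow> v" using nbhd_adj[of x w] True in_nbhd[of w v] adj_sym[of w v] by auto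
    then have "(x, w) \<in> ?E" "(w, v) \<in> ?E" using x w vertex by (simp_all add: E)
    then show ?thesis by (meson converse_rtrancl_into_rtrancl r_into_rtrancl)
  qed
  have comp: "?R `` {x} = (if x \<in> ?U then {x} else verts G - ?U)" if x: "x \<in> verts G" for x
  proof (cases "x \<in> ?U")
    case True
    then have "y \<in> ?R `` {x} \<longleftrightarrow> y = x" for y
      unfolding V Image_singleton_iff Int_iff mem_Sigma_iff
      using x stay rtrancl.rtrancl_refl by metis
    then have "?R `` {x} = {x}" by (simp add: set_eq_iff)
    with True show ?thesis by simp
  next
    case False
    have "(x, y) \<in> ?E\<^sup>*" if "y \<in> verts G - ?U" for y
      using to_v[OF that] to_v[of x] False x sym by (meson DiffI rtrancl_trans symD)
    then have "y \<in> ?R `` {x} \<longleftrightarrow> y \<in> verts G - ?U" for y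
      unfolding V Image_singleton_iff Int_iff mem_Sigma_iff Diff_iff
      using x stay False by metis
    then have "?R `` {x} = verts G - ?U" by (rule set_eqI)
    with False show ?thesis by simp
  qed
  have vU: "v \<in> verts G - ?U" using vertex not_universal by simp
  have sub: "?U \<subseteq> verts G" by (auto simp: universal_vertex_def)
  have "connected_components ?I = (\<lambda>x. ?R `` {x}) ` verts G"
    unfolding connected_components_def quotient_def V by (rule UNION_singleton_eq_range)
  also have "\<dots> = (\<lambda>x. if x \<in> ?U then {x} else verts G - ?U) ` verts G"
    using comp by (rule image_cong[OF refl])
  also have "\<dots> = insert (verts G - ?U) ((\<lambda>u. {u}) ` ?U)"
    (is "?f ` _ = ?C")
  proof (rule equalityI)
    show "?f ` verts G \<subseteq> ?C" by auto
    have "verts G - ?U \<in> ?f ` verts G"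
    proof (rule image_eqI)
      show "verts G - ?U = ?f v" using not_universal by simp
    qed (rule vertex)
    moreover have "{u} \<in> ?f ` verts G" if "u \<in> ?U" for u
    proof (rule image_eqI)
      show "{u} = ?f u" using that by simp
      show "u \<in> verts G" using that sub by auto
    qed
    ultimately show "?C \<subseteq> ?f ` verts G" by auto
  qed
  finally have "connected_components ?I = insert (verts G - ?U) ((\<lambda>u. {u}) ` ?U)" .
  \<comment> \<open>The large class contains \<open>v\<close>, which is not universal, so it differs
    from every singleton class and contributes the 1.\<close>
  moreover have "verts G - ?U \<notin> (\<lambda>u. {u}) ` ?U" using vU by blast
  moreover have "finite ?U" using sub finite_verts finite_subset by blast
  ultimately show ?thesis by (simp add: card_image)
qed

end

section \<open>Choice of the link matchings and the final count\<close>

theorem theorem1p1: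
  fixes G :: "('a, 'b) pre_digraph"
    and v :: 'a
    and k :: nat
    and \<V> :: "'a \<Rightarrow> ('a set \<times> 'a set) set"
  assumes "graph G"
    and "v \<in> verts G"
    and "{v} \<subset> closed_nbhd G v"
    and "closed_nbhd G v \<subset> verts G"
    and "clique G (closed_nbhd G v)"
    and "k = card {u. universal_vertex G u}"
    and "\<forall>u\<in>nbhd G v.
           acyclic_matching (independence_complex (delete_verts G (closed_nbhd G u))) (\<V> u)"
  shows "\<exists>M. acyclic_matching (independence_complex G) M
    \<and> num_critical 0 M (independence_complex G) = 1 + k
    \<and> 1 + k = card (connected_components (independence_complex G))
    \<and> int (num_critical 1 M (independence_complex G)) =
        (\<Sum>u\<in>nbhd G v.
           int (num_critical 0 (\<V> u) (independence_complex (delete_verts G (closed_nbhd G u)))))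
        - (int (card (nbhd G v)) - int k)
    \<and> (\<forall>t\<ge>2. num_critical t M (independence_complex G) =
        (\<Sum>u\<in>nbhd G v.
           num_critical (t - 1) (\<V> u)
             (independence_complex (delete_verts G (closed_nbhd G u)))))"
proof -
  interpret graph G by fact
  interpret simplicial_vertex G v
    using assms by unfold_locales
  let ?I = "independence_complex G" and ?N = "nbhd G v"
  let ?L = "link ?I"
  have verts: "u \<in> verts G" if "u \<in> ?N" for u using that by (simp add: nbhd_def)
  have L: "independence_complex (delete_verts G (closed_nbhd G u)) = ?L u" if "u \<in> ?N" for u
    using link_independence_complex verts that by blast
  \<comment> \<open>Each \<open>\<V> u\<close> is replaced by its reduced form; all the counts are
    stated together so that one choice of \<open>W\<close> serves for all of them.\<close>
  have "\<exists>W. acyclic_matching (?L u) W \<and>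
      num_unmatched 0 W (?L u) = of_bool (universal_vertex G u) \<and>
      num_critical 0 (\<V> u) (?L u) = num_unmatched 1 W (?L u) + of_bool (\<not> universal_vertex G u) \<and>
      (\<forall>t\<ge>1. num_critical t (\<V> u) (?L u) = num_unmatched (Suc t) W (?L u))" if u: "u \<in> ?N" for u
  proof -
    have V: "acyclic_matching (?L u) (\<V> u)" using assms(7) L u by auto
    have sub: "?L u \<subseteq> ?I" by (auto simp: link_def independence_complex_def)
    then have fin: "finite (?L u)" using independence_complex_finite finite_subset by blast
    have fins: "finite \<sigma>" if "\<sigma> \<in> ?L u" for \<sigma>
      using that sub independence_complex_finite_simplex by blast
    have down: "\<forall>\<sigma>\<in>?L u. Pow \<sigma> \<subseteq> ?L u"
      by (auto simp: link_def independence_complex_def) (metis subsetD)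
    have empty: "{} \<in> ?L u"
      unfolding L[OF u, symmetric] by (simp add: independence_complex_def)
    show ?thesis
      using acyclic_matching_reduced[OF V fin fins down empty]
      unfolding link_trivial_iff_universal[OF verts[OF u]] by metis
  qed
  then obtain W where W: "\<And>u. u \<in> ?N \<Longrightarrow> acyclic_matching (?L u) (W u)"
    "\<And>u. u \<in> ?N \<Longrightarrow> num_unmatched 0 (W u) (?L u) = of_bool (universal_vertex G u)"
    "\<And>u. u \<in> ?N \<Longrightarrow> num_critical 0 (\<V> u) (?L u) =
      num_unmatched 1 (W u) (?L u) + of_bool (\<not> universal_vertex G u)"
    "\<And>u t. \<lbrakk>u \<in> ?N; t \<ge> 1\<rbrakk> \<Longrightarrow>
      num_critical t (\<V> u) (?L u) = num_unmatched (Suc t) (W u) (?L u)"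
    by metis
  interpret cone_with_links ?I ?N v W
    using W(1) by (rule cone_with_links_independence_complex)
  have univ: "?N \<inter> {u. universal_vertex G u} = {u. universal_vertex G u}"
    using universal_in_nbhd by blast
  have k: "(\<Sum>u\<in>?N. of_bool (universal_vertex G u)) = k"
    using finite_nbhd univ assms(6) by simp
  \<comment> \<open>The critical vertices are \<open>{v}\<close> and the \<open>{u}\<close> with
    \<open>{}\<close> unmatched in the link, that is, with \<open>u\<close> universal.\<close>
  have "num_critical 0 glued ?I = 1 + k"
    using W(2) k by (simp add: num_critical_glued)
  moreover have "int (num_critical 1 glued ?I) =
      (\<Sum>u\<in>?N. int (num_critical 0 (\<V> u) (?L u))) - (int (card ?N) - int k)"
  proof -
    \<comment> \<open>Adding \<open>k\<close> lets the two indicators sum to 1 for each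
      \<open>u\<close> and avoids truncated subtraction on \<open>nat\<close>.\<close>
    have "(\<Sum>u\<in>?N. num_critical 0 (\<V> u) (?L u)) + k =
        (\<Sum>u\<in>?N. num_unmatched 1 (W u) (?L u) + of_bool (\<not> universal_vertex G u)
          + of_bool (universal_vertex G u))"
      using W(3) by (simp add: k[symmetric] sum.distrib)
    also have "\<dots> = (\<Sum>u\<in>?N. num_unmatched 1 (W u) (?L u) + 1)"
      by (intro sum.cong) auto
    also have "\<dots> = num_critical 1 glued ?I + card ?N"
      by (simp only: num_critical_glued sum.distrib) simp
    finally have "int (\<Sum>u\<in>?N. num_critical 0 (\<V> u) (?L u)) + int k =
        int (num_critical 1 glued ?I) + int (card ?N)"
      by (simp only: of_nat_add[symmetric])
    then show ?thesis by simp
  qed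
  moreover have "num_critical t glued ?I = (\<Sum>u\<in>?N. num_critical (t - 1) (\<V> u) (?L u))"
    if "t \<ge> 2" for t
    \<comment> \<open>Here \<open>t - 1\<close> is at least 1, so the exceptional dimension 0 of the
      links does not occur.\<close>
    using W(4)[of _ "t - 1"] that by (simp add: num_critical_glued)
  ultimately show ?thesis
    using acyclic_matching_glued card_connected_components assms(6) L
    by (intro exI[of _ glued]) simp
qed

end
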